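(* Let $p$ be a prime with $p \equiv 2$ or $p \equiv 5 \pmod 9$. Then there exists a nontrivial infinite $F$-set in $\mathbb{F}_p[x]$; that is, there is an infinite set $\mathcal{S}$ of monic irreducible polynomials in $\mathbb{F}_p[x]$ which does not contain every monic irreducible polynomial of $\mathbb{F}_p[x]$, and which has the property that whenever $P \in \mathcal{S}$ and $Q$ is a monic irreducible polynomial in $\mathbb{F}_p[x]$ dividing $P - \alpha_P$ (where $\alpha_P$ is the constant term of $P$), then $Q \in \mathcal{S}$.
   Context: For a prime power $q$, $\mathbb{F}_q$ denotes the finite field with $q$ elements. An $F$-set in $\mathbb{F}_q[x]$ is a set $\mathcal{S}$ of monic irreducible polynomials in $\mathbb{F}_q[x]$ such that if $P \in \mathcal{S}$, $\alpha_P$ denotes the constant term of $P$, and $Q$ is a monic irreducible polynomial with $Q \mid (P - \alpha_P)$, then $Q \in \mathcal{S}$. An $F$-set is nontrivial if it is not the set of all monic irreducible polynomials of $\mathbb{F}_q[x]$. *)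

theory Defs
  imports "HOL-Computational_Algebra.Computational_Algebra" "HOL-Number_Theory.Cong" "HOL-Library.Cardinality"
begin

(* The coefficient field F_q is any type of class finite_field; its order q is CARD('a).
   The constant polynomial [:coeff P 0:] is the constant term alpha_P viewed inside F_q[x]. *)

definition monic_irreducibles :: "'a::finite_field poly set" where
  "monic_irreducibles = {P. lead_coeff P = 1 \<and> irreducible P}"

definition F_set :: "'a::finite_field poly set \<Rightarrow> bool" where
  "F_set S \<longleftrightarrow> S \<subseteq> monic_irreducibles \<and>
     (\<forall>P\<in>S. \<forall>Q\<in>monic_irreducibles. Q dvd P - [:coeff P 0:] \<longrightarrow> Q \<in> S)"

definition nontrivial_F_set :: "'a::finite_field poly set \<Rightarrow> bool" where
  "nontrivial_F_set S \<longleftrightarrow> F_set S \<and> S \<noteq> monic_irreducibles"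

end

theory Submission
  imports Defs "HOL-Number_Theory.Residue_Primitive_Roots"
begin

text \<open>
  The primes \<open>p \<equiv> 2, 5 (mod 9)\<close> are primitive roots modulo every power of 3. An irreducible factor
  of degree \<open>d\<close> of the cyclotomic polynomial \<open>\<Phi>\<^sub>k = x^(2\<cdot>3^k) + x^(3^k) + 1\<close> gives an element of
  order \<open>3^(k+1)\<close> in a field with \<open>p^d\<close> elements, which forces \<open>2\<cdot>3^k\<close> to divide \<open>d\<close>; so \<open>\<Phi>\<^sub>k(x)\<close>
  and \<open>\<Phi>\<^sub>k(-x)\<close> are irreducible. The set consisting of \<open>x\<close>, \<open>x - 1\<close>, \<open>x + 1\<close> and all \<open>\<Phi>\<^sub>k(\<plusminus>x)\<close> is an
  F-set, because \<open>\<Phi>\<^sub>k(x) - 1 = x^(3^k) (x^(3^k) + 1)\<close> and \<open>x^(3^k) - 1 = (x - 1) \<Phi>\<^sub>0 \<cdots> \<Phi>\<^bsub>k-1\<^esub>\<close>. It is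
  nontrivial because of \<open>x^3 + x + 1\<close> when \<open>p = 2\<close> and of \<open>x - 2\<close> when \<open>p \<ge> 5\<close>.
\<close>

section \<open>Fermat's little theorem modulo an irreducible polynomial\<close>

lemma card_poly_degree_less:
  "finite {f :: 'a::{finite,zero} poly. f = 0 \<or> degree f < d} \<and>
   card {f :: 'a poly. f = 0 \<or> degree f < d} = CARD('a) ^ d"
proof (induction d)
  case 0
  \<comment> \<open>Since \<open>degree 0 = 0\<close> is not below 0, it is the disjunct
    \<open>f = 0\<close> that makes the count 1 here.\<close>
  have "{f :: 'a poly. f = 0 \<or> degree f < 0} = {0}" by auto
  then show ?case by simp
next
  case (Suc d)
  let ?A = "\<lambda>d. {f :: 'a poly. f = 0 \<or> degree f < d}"
  have eq: "?A (Suc d) = (\<lambda>(a, f). pCons a f) ` (UNIV \<times> ?A d)"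
  proof (intro equalityI subsetI)
    fix f assume "f \<in> ?A (Suc d)"
    then show "f \<in> (\<lambda>(a, f). pCons a f) ` (UNIV \<times> ?A d)"
      by (cases f) (auto simp: image_iff degree_pCons_eq_if split: if_splits)
  qed (auto simp: degree_pCons_eq_if split: if_splits)
  have "inj_on (\<lambda>(a, f). pCons a f) (UNIV \<times> ?A d)"
    by (auto simp: inj_on_def)
  with Suc show ?case
    unfolding eq by (simp add: card_image card_cartesian_product)
qed

text \<open>Multiplication by \<open>g\<close> permutes the nonzero residues modulo
  \<open>R\<close>, represented by the nonzero polynomials of smaller degree. Comparing the products
  before and after and cancelling the common product, which is prime to \<open>R\<close>, gives the
  claim.\<close>

lemma irreducible_poly_fermat:
  fixes R g :: "'a::{field,finite} poly"
  assumes R: "irreducible R" and g: "\<not> R dvd g"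
  shows "R dvd g ^ (CARD('a) ^ degree R - 1) - 1"
proof -
  have prime: "prime_elem R" using R by (rule field_poly_irreducible_imp_prime)
  have R0: "R \<noteq> 0" using R by auto
  define A where "A = {f :: 'a poly. f = 0 \<or> degree f < degree R} - {0}"
  have fin: "finite A" and card: "card A = CARD('a) ^ degree R - 1"
    using card_poly_degree_less[where 'a='a and d="degree R"] by (simp_all add: A_def)
  have ndvd: "\<not> R dvd f" if "f \<in> A" for f
    using that by (auto simp: A_def dest: dvd_imp_degree_le)
  let ?h = "\<lambda>f. (g * f) mod R"
  have "inj_on ?h A"
  proof (rule inj_onI)
    fix f1 f2 assume f: "f1 \<in> A" "f2 \<in> A" "?h f1 = ?h f2"
    then have "R dvd g * (f1 - f2)"
      by (simp add: mod_eq_dvd_iff right_diff_distrib)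
    with prime g have "R dvd f1 - f2" by (simp add: prime_elem_dvd_mult_iff)
    moreover have "f1 - f2 = 0 \<or> degree (f1 - f2) < degree R"
      using f by (auto simp: A_def intro: degree_diff_less)
    ultimately have "f1 - f2 = 0"
      using dvd_imp_degree_le[of R "f1 - f2"] by linarith
    then show "f1 = f2" by simp
  qed
  moreover have "?h ` A \<subseteq> A"
  proof (intro image_subsetI)
    fix f assume "f \<in> A"
    then have "\<not> R dvd g * f" using prime g ndvd by (simp add: prime_elem_dvd_mult_iff)
    then have "?h f \<noteq> 0" by (simp add: mod_eq_0_iff_dvd)
    moreover from this have "degree (?h f) < degree R"
      using degree_mod_less[OF R0, of "g * f"] by auto
    ultimately show "?h f \<in> A" by (simp add: A_def)
  qed
  ultimately have "bij_betw ?h A A"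
    using fin by (simp add: bij_betw_def endo_inj_surj)
  then have "(\<Prod>f\<in>A. ?h f) = \<Prod>A"
    by (rule prod.reindex_bij_betw)
  moreover have "(\<Prod>f\<in>A. ?h f) mod R = (\<Prod>f\<in>A. g * f) mod R"
    by (rule mod_prod_eq)
  ultimately have "(g ^ card A * \<Prod>A) mod R = \<Prod>A mod R"
    by (simp add: prod.distrib)
  then have "R dvd (g ^ card A - 1) * \<Prod>A"
    by (simp add: mod_eq_dvd_iff left_diff_distrib)
  moreover have "\<not> R dvd \<Prod>A"
    using fin ndvd
  proof (induction A)
    case empty
    with R show ?case by (simp add: irreducible_def)
  next
    case (insert f A)
    with prime show ?case by (simp add: prime_elem_dvd_mult_iff)
  qed
  ultimately show ?thesis
    using prime by (simp add: prime_elem_dvd_mult_iff card)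
qed

section \<open>Orders modulo a prime element\<close>

lemma minus_one_dvd_power_minus_one: "x - 1 dvd x ^ n - (1 :: 'a::comm_ring_1)"
  by (simp add: power_diff_1_eq)

text \<open>Bezout over the naturals writes the gcd as a difference \<open>a * s - b * t\<close>;
  the leftover factor \<open>y ^ (b * t)\<close> cancels because the prime \<open>R\<close> does not
  divide \<open>y\<close>. This replaces order arguments in the quotient by
  \<open>R\<close>.\<close>

lemma dvd_power_gcd_minus_one:
  fixes R y :: "'a::comm_ring_1"
  assumes R: "prime_elem R" and y: "\<not> R dvd y"
    and a: "R dvd y ^ a - 1" and b: "R dvd y ^ b - 1" and "a \<noteq> 0"
  shows "R dvd y ^ gcd a b - 1"
proof -
  obtain s t where st: "a * s = b * t + gcd a b"
    using bezout_nat[OF \<open>a \<noteq> 0\<close>] by blast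
  have dvd: "R dvd y ^ (c * s) - 1" if "R dvd y ^ c - 1" for c s
    unfolding power_mult using that minus_one_dvd_power_minus_one by (rule dvd_trans)
  have "y ^ (b * t) * (y ^ gcd a b - 1) = (y ^ (a * s) - 1) - (y ^ (b * t) - 1)"
    by (simp add: st power_add algebra_simps)
  then have "R dvd y ^ (b * t) * (y ^ gcd a b - 1)"
    using dvd[OF a, of s] dvd[OF b, of t] by (metis dvd_diff)
  then show ?thesis
    using R y prime_elem_dvd_power by (metis prime_elem_dvd_mult_iff)
qed

section \<open>Irreducible factors and monic irreducible polynomials\<close>

lemma irreducible_factor_exists:
  fixes P :: "'a::field poly"
  assumes "degree P > 0"
  obtains R where "irreducible R" "R dvd P"
proof -
  have "\<exists>R. irreducible R \<and> R dvd P"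
    using assms
  proof (induction "degree P" arbitrary: P rule: less_induct)
    case less
    show ?case
    proof (cases "irreducible P")
      case False
      have P0: "P \<noteq> 0" using less.prems by auto
      then have "\<not> is_unit P" using less.prems by (simp add: is_unit_iff_degree)
      with False P0 obtain a b where ab: "P = a * b" "\<not> is_unit a" "\<not> is_unit b"
        by (auto simp: irreducible_def)
      with less.prems have "a \<noteq> 0" "b \<noteq> 0" by auto
      with ab have "degree a > 0" "degree a < degree P"
        by (auto simp: is_unit_iff_degree degree_mult_eq)
      with less.hyps ab show ?thesis by (meson dvd_mult2)
    qed auto
  qed
  with that show thesis by blast
qed

text \<open>An irreducible factor of full degree has a unit cofactor, so irreducibility reduces to a
  lower bound on the degrees of irreducible factors.\<close>

lemma irreducible_if_degree_le_factors:
  fixes P :: "'a::field poly"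
  assumes "degree P > 0" and le: "\<And>R. irreducible R \<Longrightarrow> R dvd P \<Longrightarrow> degree P \<le> degree R"
  shows "irreducible P"
proof -
  obtain R where R: "irreducible R" "R dvd P" using irreducible_factor_exists assms(1) .
  then obtain c where c: "P = R * c" by auto
  from assms(1) have "P \<noteq> 0" by auto
  with c have "R \<noteq> 0" "c \<noteq> 0" by auto
  with le[OF R] c have "is_unit c" by (simp add: is_unit_iff_degree degree_mult_eq)
  with R c show ?thesis by (simp add: mult.commute[of R] irreducible_mult_unit_left)
qed

text \<open>The cofactor is a constant, and comparing leading coefficients makes it 1. This
  identifies the divisors \<open>Q\<close> in the definition of an F-set with explicit
  members.\<close>

lemma monic_irreducibles_dvd_imp_eq:
  assumes "P \<in> monic_irreducibles" "Q \<in> monic_irreducibles" "Q dvd P"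
  shows "Q = P"
proof -
  obtain c where c: "P = Q * c" using assms(3) by auto
  have "is_unit c"
    using assms(1,2) c irreducibleD[of P Q c]
    by (auto simp: monic_irreducibles_def irreducible_def)
  then obtain a where "c = [:a:]" by (auto elim: is_unit_polyE)
  moreover from this have "a = 1"
    using assms(1,2) c by (cases "a = 0") (auto simp: monic_irreducibles_def)
  ultimately show ?thesis using c by simp
qed

lemma monic_linear_in_monic_irreducibles: "[:c, 1:] \<in> monic_irreducibles"
  by (simp add: monic_irreducibles_def irreducible_linear_field_poly)

section \<open>The cyclotomic polynomials of order 3^(k+1), evaluated at ax\<close>

definition Phi :: "'a::field \<Rightarrow> nat \<Rightarrow> 'a poly" where
  "Phi a k = [:0, a:] ^ (2 * 3 ^ k) + [:0, a:] ^ (3 ^ k) + 1"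

lemma degree_Phi:
  assumes "a \<noteq> 0"
  shows "degree (Phi a k) = 2 * 3 ^ k"
proof -
  have "degree ([:0, a:] ^ (3 ^ k) + 1) < 2 * 3 ^ k"
    using assms by (intro degree_add_less) (auto simp: degree_power_eq)
  then show ?thesis
    using assms unfolding Phi_def add.assoc
    by (subst degree_add_eq_left) (auto simp: degree_power_eq)
qed

lemma lead_coeff_Phi:
  assumes "a = 1 \<or> a = -1"
  shows "lead_coeff (Phi a k) = 1"
proof -
  have a0: "a \<noteq> 0" using assms by auto
  have "degree ([:0, a:] ^ (3 ^ k) + 1) < 2 * 3 ^ k"
    using a0 by (intro degree_add_less) (auto simp: degree_power_eq)
  then have "lead_coeff (Phi a k) = lead_coeff ([:0, a:] ^ (2 * 3 ^ k))"
    using a0 lead_coeff_add_le[of "[:0, a:] ^ (3 ^ k) + 1" "[:0, a:] ^ (2 * 3 ^ k)"]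
    by (simp add: Phi_def degree_power_eq add_ac)
  \<comment> \<open>The exponent is even, so the sign of \<open>a\<close> disappears.\<close>
  also have "\<dots> = 1" using assms by (auto simp: lead_coeff_power power_mult)
  finally show ?thesis .
qed

lemma coeff_0_Phi: "poly.coeff (Phi a k) 0 = 1"
  by (simp add: Phi_def coeff_0_power power_0_left)

text \<open>This is z^3 - 1 = (z - 1)(z^2 + z + 1) at z = (ax)^(3^k).\<close>

lemma Phi_cube: "[:0, a:] ^ 3 ^ Suc k - 1 = ([:0, a:] ^ 3 ^ k - 1) * Phi a k"
proof -
  define z where "z = [:0, a:] ^ 3 ^ k"
  have "[:0, a:] ^ 3 ^ Suc k = z ^ 3" "Phi a k = z ^ 2 + z + 1"
    by (simp_all add: Phi_def z_def power_mult[symmetric] mult.commute)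
  then show ?thesis
    by (simp add: z_def[symmetric] power2_eq_square power3_eq_cube algebra_simps)
qed

text \<open>Iterating \<open>Phi_cube\<close> splits the power minus one into ax - 1 and polynomials
  \<open>Phi a i\<close>; a prime divisor divides one of them.\<close>

lemma prime_elem_dvd_x_power_minus_one:
  assumes "prime_elem Q" "Q dvd [:0, a:] ^ 3 ^ k - 1"
  shows "Q dvd [:-1, a:] \<or> (\<exists>i. Q dvd Phi a i)"
  using assms(2)
proof (induction k)
  case 0
  then show ?case by (simp add: one_pCons)
next
  case (Suc k)
  then show ?case
    unfolding Phi_cube using assms(1) by (auto simp: prime_elem_dvd_mult_iff)
qed

section \<open>Primitive roots modulo powers of 3, and irreducibility\<close>

lemma ord_three_power:
  fixes p :: nat
  assumes p: "[p = 2] (mod 9) \<or> [p = 5] (mod 9)"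
  shows "ord (3 ^ Suc k) p = 2 * 3 ^ k"
proof -
  have mod9: "p mod 9 = 2 \<or> p mod 9 = 5" using p by (simp add: cong_def)
  have "p mod 3 = p mod 9 mod 3" by (simp add: mod_mod_cancel)
  with mod9 have mod3: "p mod 3 = 2" by auto
  have "p ^ 2 mod 9 = (p mod 9) ^ 2 mod 9" by (rule power_mod[symmetric])
  \<comment> \<open>The squares are 4 and 7 modulo 9. This is the condition under which a primitive
    root modulo 3 stays one modulo every power of 3.\<close>
  with mod9 have sq: "[p ^ 2 \<noteq> 1] (mod 9)" by (auto simp: cong_def)
  have pr: "prime (3::nat)" by simp
  have "p ^ 2 mod 3 = (p mod 3) ^ 2 mod 3" by (rule power_mod[symmetric])
  then have "[p ^ 2 = 1] (mod 3)" by (simp add: mod3 cong_def)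
  then have "ord 3 p dvd 2" by (simp only: ord_divides)
  moreover have "ord 3 p \<noteq> 1"
    using mod3 ord_divides[of p 1 3] by (simp add: cong_def)
  ultimately have "ord 3 p = 2" using prime_nat_iff two_is_prime_nat by blast
  moreover have "coprime 3 p"
    using mod3 prime_imp_coprime[OF pr, of p] by (auto simp: mod_eq_0_iff_dvd[symmetric])
  ultimately have "residue_primroot 3 p"
    by (simp add: residue_primroot_def totient_prime[OF pr])
  then have "residue_primroot (3 ^ Suc k) p"
    using residue_primroot_prime_lift_iff[OF pr _, of p] sq by auto
  then show ?thesis
    by (simp add: residue_primroot_def totient_prime_power[OF pr] del: power_Suc)
qed

lemma irreducible_Phi:
  fixes a :: "'a::finite_field"
  assumes p: "[CARD('a) = 2] (mod 9) \<or> [CARD('a) = 5] (mod 9)"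
    and three: "(3 :: 'a) \<noteq> 0" and a: "a \<noteq> 0"
  shows "irreducible (Phi a k)"
proof (rule irreducible_if_degree_le_factors)
  show "degree (Phi a k) > 0" using degree_Phi[OF a] by simp
next
  fix R assume R: "irreducible R" and dvd: "R dvd Phi a k"
  have prime: "prime_elem R" using R by (rule field_poly_irreducible_imp_prime)
  define y where "y = [:0, a:]"
  define m where "m = CARD('a) ^ degree R - 1"
  have nunit: "\<not> is_unit R" using R by (simp add: irreducible_def)
  have Phi: "Phi a k = (y ^ 3 ^ k) ^ 2 + y ^ 3 ^ k + 1"
    by (simp add: Phi_def y_def power_mult[symmetric] mult.commute)
  have ndvd: "\<not> R dvd y"
  proof
    assume "R dvd y"
    then have "R dvd y ^ 3 ^ k" by (simp add: dvd_power_le[of R y 1, simplified])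
    then have "R dvd (y ^ 3 ^ k) ^ 2 + y ^ 3 ^ k" by (simp add: power2_eq_square)
    with dvd have "R dvd 1" unfolding Phi by (simp add: dvd_add_right_iff)
    with nunit show False by simp
  qed
  \<comment> \<open>If y^(3^k) were 1 modulo \<open>R\<close>, then \<open>Phi a k\<close> would be
    congruent to 3, a unit.\<close>
  have not_one: "\<not> R dvd y ^ 3 ^ k - 1"
  proof
    assume "R dvd y ^ 3 ^ k - 1"
    moreover have "Phi a k = (y ^ 3 ^ k - 1) * (y ^ 3 ^ k + 2) + 3"
      unfolding Phi by (simp add: power2_eq_square algebra_simps)
    ultimately have "R dvd 3" using dvd by (simp add: dvd_add_right_iff)
    moreover have "is_unit (3 :: 'a poly)"
      using three by (simp add: is_unit_iff_degree numeral_poly)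
    ultimately show False using nunit dvd_trans by blast
  qed
  have "R dvd y ^ m - 1"
    unfolding m_def using irreducible_poly_fermat[OF R ndvd] .
  moreover have "R dvd y ^ 3 ^ Suc k - 1"
    unfolding y_def Phi_cube using dvd by simp
  ultimately have g: "R dvd y ^ gcd (3 ^ Suc k) m - 1"
    using dvd_power_gcd_minus_one[OF prime ndvd, of "3 ^ Suc k" m] by simp
  \<comment> \<open>Being a divisor of 3^(k+1), the gcd is a power of 3; a smaller power than
    3^(k+1) would contradict \<open>not_one\<close>.\<close>
  obtain i where i: "i \<le> Suc k" "gcd (3 ^ Suc k) m = 3 ^ i"
    using divides_primepow_nat[of 3 "gcd (3 ^ Suc k) m" "Suc k"] by auto
  have "i = Suc k"
  proof (rule ccontr)
    assume "i \<noteq> Suc k"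
    with i have "3 ^ k = (3::nat) ^ i * 3 ^ (k - i)" by (simp flip: power_add)
    then have "y ^ 3 ^ i - 1 dvd y ^ 3 ^ k - 1"
      by (simp add: power_mult minus_one_dvd_power_minus_one)
    with g i not_one show False by (metis dvd_trans)
  qed
  with i have "3 ^ Suc k dvd m" by (metis gcd_dvd2)
  then have "[CARD('a) ^ degree R = 1] (mod 3 ^ Suc k)"
    unfolding m_def using zero_less_card_finite[where 'a='a]
    by (subst cong_altdef_nat) (auto simp: Suc_le_eq)
  then have "2 * 3 ^ k dvd degree R"
    using ord_three_power[OF p, of k] by (simp only: ord_divides)
  moreover have "degree R > 0"
    using R by (auto simp: irreducible_def is_unit_iff_degree)
  ultimately show "degree (Phi a k) \<le> degree R"
    using degree_Phi[OF a] by (simp add: dvd_imp_le)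
qed

section \<open>The F-set and its closure property\<close>

definition cyclotomic_F_set :: "'a::finite_field poly set" where
  "cyclotomic_F_set = {[:0, 1:], [:-1, 1:], [:1, 1:]} \<union> {Phi a k | a k. a = 1 \<or> a = -1}"

context
  assumes p: "[CARD('a::finite_field) = 2] (mod 9) \<or> [CARD('a) = 5] (mod 9)"
    and three: "(3 :: 'a) \<noteq> 0"
begin

lemma Phi_in_monic_irreducibles:
  "a = 1 \<or> a = -1 \<Longrightarrow> Phi (a :: 'a) k \<in> monic_irreducibles"
  using irreducible_Phi[OF p three, of a k] lead_coeff_Phi[of a k]
  by (auto simp: monic_irreducibles_def)

lemma F_set_cyclotomic: "F_set (cyclotomic_F_set :: 'a poly set)"
  unfolding F_set_def
proof (intro conjI ballI impI)
  show "cyclotomic_F_set \<subseteq> (monic_irreducibles :: 'a poly set)"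
    by (auto simp: cyclotomic_F_set_def Phi_in_monic_irreducibles monic_linear_in_monic_irreducibles)
next
  fix P Q :: "'a poly"
  assume P: "P \<in> cyclotomic_F_set" and Q: "Q \<in> monic_irreducibles" and dvd: "Q dvd P - [:poly.coeff P 0:]"
  have prime: "prime_elem Q"
    using Q by (simp add: monic_irreducibles_def field_poly_irreducible_imp_prime)
  have x: "Q \<in> cyclotomic_F_set" if "Q dvd [:0, 1:]"
    using monic_irreducibles_dvd_imp_eq[OF monic_linear_in_monic_irreducibles Q that]
    by (simp add: cyclotomic_F_set_def)
  from P consider "P = [:0, 1:] \<or> P = [:-1, 1:] \<or> P = [:1, 1:]"
    | a k where "a = 1 \<or> a = -1" "P = Phi a k"
    by (auto simp: cyclotomic_F_set_def)
  then show "Q \<in> cyclotomic_F_set"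
  proof cases
    \<comment> \<open>Each linear member minus its constant term is x.\<close>
    case 1
    with dvd x show ?thesis by auto
  next
    case 2
    \<comment> \<open>As 3^k is odd, (ax)^(3^k) + 1 = -((bx)^(3^k) - 1). The factors of P - 1 other
      than x thus belong to the opposite sign, which is why the set contains both signs.\<close>
    define b where "b = - a"
    have b: "b = 1 \<or> b = -1" using 2 by (auto simp: b_def)
    have ab: "[:0, b:] = - [:0, a:]" by (simp add: b_def)
    have neg: "[:0, b:] ^ 3 ^ k = - ([:0, a:] ^ 3 ^ k)"
      unfolding ab by (rule power_minus_odd) simp
    have "P - [:poly.coeff P 0:] = - ([:0, a:] ^ 3 ^ k * ([:0, b:] ^ 3 ^ k - 1))"
      unfolding 2(2) coeff_0_Phi neg
      by (simp add: Phi_def mult_2 power_add one_pCons[symmetric] algebra_simps)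
    with dvd prime have "Q dvd [:0, a:] \<or> Q dvd [:0, b:] ^ 3 ^ k - 1"
      by (auto simp: prime_elem_dvd_mult_iff dest: prime_elem_dvd_power)
    then consider "Q dvd [:0, a:]" | "Q dvd [:-1, b:]" | i where "Q dvd Phi b i"
      using prime_elem_dvd_x_power_minus_one[OF prime] by blast
    then show ?thesis
    proof cases
      case 1
      have "[:0, a:] = [:0, 1:] \<or> [:0, a:] = - [:0, 1:]" using 2 by auto
      with 1 x show ?thesis by (metis dvd_minus_iff)
    next
      case 2
      \<comment> \<open>For b = -1 the linear factor is -(x + 1); the sign does not affect
        divisibility.\<close>
      have "[:-1, b:] = [:-1, 1:] \<or> [:-1, b:] = - [:1, 1:]" using b by auto
      with 2 have "Q dvd [:-1, 1:] \<or> Q dvd [:1, 1:]" by (metis dvd_minus_iff)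
      then show ?thesis
        using monic_irreducibles_dvd_imp_eq[OF monic_linear_in_monic_irreducibles Q]
        by (auto simp: cyclotomic_F_set_def)
    next
      case 3
      then have "Q = Phi b i"
        using monic_irreducibles_dvd_imp_eq[OF Phi_in_monic_irreducibles[OF b] Q] by simp
      with b show ?thesis by (auto simp: cyclotomic_F_set_def)
    qed
  qed
qed

end

section \<open>Infinitude and nontriviality\<close>

lemma infinite_cyclotomic_F_set: "infinite (cyclotomic_F_set :: 'a::finite_field poly set)"
proof -
  have "inj (\<lambda>k. Phi (1::'a) k)"
  proof (rule injI)
    fix j k assume "Phi (1::'a) j = Phi 1 k"
    then have "degree (Phi (1::'a) j) = degree (Phi (1::'a) k)" by simp
    then show "j = k" by (simp add: degree_Phi)
  qed
  then have "infinite (range (\<lambda>k. Phi (1::'a) k))" by (simp add: finite_image_iff)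
  then show ?thesis
    by (rule infinite_super[rotated]) (auto simp: cyclotomic_F_set_def)
qed

text \<open>This excludes a cubic. Over two elements the set contains both monic linear polynomials,
  so a missing polynomial must have higher degree.\<close>

lemma degree_cyclotomic_F_set:
  "P \<in> cyclotomic_F_set \<Longrightarrow> degree P = 1 \<or> even (degree P)"
  by (auto simp: cyclotomic_F_set_def degree_Phi)

text \<open>A reducible cubic has a linear factor and hence a root, but x^3 + x + 1 takes the value
  1 at both 0 and 1.\<close>

lemma irreducible_cubic_CARD_2:
  assumes "CARD('a::finite_field) = 2"
  shows "irreducible ([:1, 1, 0, 1:] :: 'a poly)"
proof (rule ccontr)
  let ?f = "[:1, 1, 0, 1:] :: 'a poly"
  assume "\<not> irreducible ?f"
  then obtain u v where uv: "?f = u * v" "\<not> is_unit u" "\<not> is_unit v"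
    by (auto simp: irreducible_def is_unit_iff_degree)
  then have "u \<noteq> 0" "v \<noteq> 0" by auto
  then have "degree ?f = degree u + degree v" "degree u > 0" "degree v > 0"
    using uv degree_mult_eq[of u v] by (auto simp: is_unit_iff_degree simp del: degree_pCons_eq_if)
  moreover have "degree ?f = 3" by simp
  ultimately have "degree u = 1 \<or> degree v = 1" by linarith
  then obtain l where l: "l dvd ?f" "degree l = 1" using uv(1) by (metis dvd_triv_left dvd_triv_right)
  then obtain c d where "l = [:c, d:]" "d \<noteq> 0" using degree1_coeffs by blast
  then have "poly l (- c / d) = 0" by simp
  with l obtain z where z: "poly ?f z = 0" by (metis dvdE mult_zero_left poly_mult)
  have "UNIV = {0, 1 :: 'a}"
    by (rule card_subset_eq[symmetric]) (simp_all add: assms)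
  then have "z = 0 \<or> z = 1" by blast
  moreover have "CHAR('a) = 2"
    using CHAR_dvd_CARD[where 'a='a] assms prime_CHAR_semidom
    by (metis CHAR_not_1' One_nat_def prime_nat_iff two_is_prime_nat)
  then have "(1 :: 'a) + 1 = 0" by (metis of_nat_CHAR of_nat_numeral one_add_one)
  ultimately show False using z by (auto simp: algebra_simps)
qed

theorem theorem1p1:
  fixes p :: nat
  assumes "prime p"
    and "[p = 2] (mod 9) \<or> [p = 5] (mod 9)"
    and "CARD('a::finite_field) = p"
  shows "\<exists>S :: 'a poly set. nontrivial_F_set S \<and> infinite S"
proof -
  have CHAR: "CHAR('a) = p"
    using CHAR_dvd_CARD[where 'a='a] assms(1,3) by (metis CHAR_not_1' One_nat_def prime_nat_iff)
  have nz: "(numeral n :: 'a) \<noteq> 0" if "\<not> p dvd numeral n" for n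
    using that of_nat_eq_0_iff_char_dvd[of "numeral n", where 'a='a] CHAR by simp
  have p3: "p \<noteq> 3" using assms(2) by (auto simp: cong_def)
  have three: "(3 :: 'a) \<noteq> 0"
    using p3 assms(1) primes_dvd_imp_eq[of p 3] by (intro nz) auto
  have "\<exists>P :: 'a poly. P \<in> monic_irreducibles \<and> P \<notin> cyclotomic_F_set"
  proof (cases "p = 2")
    case True
    then have "[:1, 1, 0, 1:] \<in> (monic_irreducibles :: 'a poly set)"
      using irreducible_cubic_CARD_2 assms(3) by (auto simp: monic_irreducibles_def)
    moreover have "[:1, 1, 0, 1:] \<notin> (cyclotomic_F_set :: 'a poly set)"
      by (auto dest: degree_cyclotomic_F_set)
    ultimately show ?thesis by blast
  next
    case False
    then have two: "(2 :: 'a) \<noteq> 0"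
      using assms(1) primes_dvd_imp_eq[of p 2] by (intro nz) auto
    \<comment> \<open>The degree of \<open>Phi a k\<close> is even, which leaves the linear members:
      -2 equals 0, 1 or -1 only if 2, 3 or 1 vanishes, respectively.\<close>
    have "[:-2, 1:] \<noteq> Phi a k" if "a = 1 \<or> a = -1" for a :: 'a and k
    proof
      assume "[:-2, 1:] = Phi a k"
      then have "degree [:-2, 1 :: 'a:] = degree (Phi a k)" by (rule arg_cong)
      with that show False by (auto simp: degree_Phi)
    qed
    moreover have "(-2 :: 'a) \<noteq> 1" using three by (auto simp: neg_eq_iff_add_eq_0)
    moreover have "(-2 :: 'a) \<noteq> -1"
      by (metis add.right_neutral add_left_cancel neg_equal_iff_equal one_add_one zero_neq_one)
    ultimately have "[:-2, 1:] \<notin> (cyclotomic_F_set :: 'a poly set)"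
      using two by (auto simp: cyclotomic_F_set_def)
    with monic_linear_in_monic_irreducibles show ?thesis by blast
  qed
  then have "nontrivial_F_set (cyclotomic_F_set :: 'a poly set)"
    using F_set_cyclotomic three assms(2,3) by (auto simp: nontrivial_F_set_def)
  with infinite_cyclotomic_F_set show ?thesis by blast
qed

end
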